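(* Let $f:\mathbb{R}\to\mathbb{R}$ be continuous with $\lim_{|x|\to\infty} f(x)/x=0$, let $k=(k(n))_{n\ge 0}$ be a real sequence with $\sum_{j=0}^\infty |k(j)|<+\infty$, let $(H(n))_{n\ge 1}$ be a real sequence, let $\xi\in\mathbb{R}$, and let $(x(n))_{n\ge 0}$ be the real sequence defined by $x(0)=\xi$ and $$x(n+1)=H(n+1)+\sum_{j=0}^n k(n-j)f(x(j)),\quad n\ge 0.$$ Let $(a(n))_{n\ge 1}$ be an increasing and positive sequence such that $a(n)\to\infty$ as $n\to\infty$. Then the following are equivalent: (a) $H\in B_a$ and $\Lambda_a H$ is asymptotically non-null; (b) $x\in B_a$ and $\Lambda_a x$ is asymptotically non-null. Moreover, both imply that we may take $\Lambda_a x=\Lambda_a H$.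
   Context: For an increasing positive sequence $a$, $B_a$ denotes the set of real sequences $y$ with $\limsup_{n\to\infty}|y(n)|/a(n)<+\infty$. For $y\in B_a$, $\Lambda_a y$ denotes a bounded sequence (unique up to asymptotic equality, i.e. up to adding a sequence tending to $0$) such that $$\lim_{n\to\infty}\left|\frac{y(n)}{a(n)}-(\Lambda_a y)(n)\right|=0.$$ The sequence $\Lambda_a y$ is asymptotically non-null if it does not tend to $0$, i.e. $\limsup_{n\to\infty}|(\Lambda_a y)(n)|>0$. "We may take $\Lambda_a x=\Lambda_a H$" means that a bounded sequence satisfying the defining limit for $H$ also satisfies it for $x$. *)

theory Defs
  imports "HOL-Analysis.Analysis"
begin

text \<open>
  Sequences are functions on all of \<open>nat\<close>. For a sequence indexed from 1 the value at 0 is a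
  junk value; every notion below is asymptotic and so does not depend on it.
\<close>

definition B_space :: "(nat \<Rightarrow> real) \<Rightarrow> (nat \<Rightarrow> real) set" where
  "B_space a = {y. limsup (\<lambda>n. ereal (\<bar>y n\<bar> / a n)) < \<infinity>}"

text \<open>
  \<open>\<Lambda>\<^sub>a y\<close> is only determined up to adding a null sequence, so it is rendered as a relation:
  \<open>is_Lambda a y L\<close> says that \<open>L\<close> is an admissible choice of \<open>\<Lambda>\<^sub>a y\<close>. Existence on \<open>B_space a\<close>
  and uniqueness up to null sequences are proved below.
\<close>

definition is_Lambda :: "(nat \<Rightarrow> real) \<Rightarrow> (nat \<Rightarrow> real) \<Rightarrow> (nat \<Rightarrow> real) \<Rightarrow> bool" where
  "is_Lambda a y L \<longleftrightarrow> Bseq L \<and> (\<lambda>n. \<bar>y n / a n - L n\<bar>) \<longlonglongrightarrow> 0"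

definition asymp_nonnull :: "(nat \<Rightarrow> real) \<Rightarrow> bool" where
  "asymp_nonnull L \<longleftrightarrow> \<not> L \<longlonglongrightarrow> 0"

definition Lambda_nonnull :: "(nat \<Rightarrow> real) \<Rightarrow> (nat \<Rightarrow> real) \<Rightarrow> bool" where
  "Lambda_nonnull a y \<longleftrightarrow> (\<exists>L. is_Lambda a y L \<and> asymp_nonnull L)"

lemma asymp_nonnull_iff_limsup:
  "asymp_nonnull L \<longleftrightarrow> limsup (\<lambda>n. ereal \<bar>L n\<bar>) > 0"
proof -
  have "L \<longlonglongrightarrow> 0 \<longleftrightarrow> (\<lambda>n. ereal \<bar>L n\<bar>) \<longlonglongrightarrow> 0"
    using tendsto_rabs_zero_iff[of L sequentially] by (simp add: zero_ereal_def)
  also have "\<dots> \<longleftrightarrow> limsup (\<lambda>n. ereal \<bar>L n\<bar>) \<le> 0"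
  proof
    assume "(\<lambda>n. ereal \<bar>L n\<bar>) \<longlonglongrightarrow> 0"
    then show "limsup (\<lambda>n. ereal \<bar>L n\<bar>) \<le> 0"
      using lim_imp_Limsup[of sequentially] by fastforce
  next
    assume le: "limsup (\<lambda>n. ereal \<bar>L n\<bar>) \<le> 0"
    have ge: "0 \<le> liminf (\<lambda>n. ereal \<bar>L n\<bar>)"
      by (rule Liminf_bounded) simp
    show "(\<lambda>n. ereal \<bar>L n\<bar>) \<longlonglongrightarrow> 0"
      using Liminf_le_Limsup[of sequentially "\<lambda>n. ereal \<bar>L n\<bar>"] le ge
      by (intro Liminf_eq_Limsup) auto
  qed
  finally show ?thesis
    by (auto simp: asymp_nonnull_def)
qed

lemma is_Lambda_unique:
  assumes "is_Lambda a y L" "is_Lambda a y L'"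
  shows "(\<lambda>n. L n - L' n) \<longlonglongrightarrow> 0"
proof -
  have "(\<lambda>n. y n / a n - L n) \<longlonglongrightarrow> 0" "(\<lambda>n. y n / a n - L' n) \<longlonglongrightarrow> 0"
    using assms by (auto simp: is_Lambda_def tendsto_rabs_zero_iff)
  from tendsto_diff[OF this(2,1)] show ?thesis by simp
qed

lemma Lambda_nonnull_cong:
  assumes "is_Lambda a y L"
  shows "Lambda_nonnull a y \<longleftrightarrow> asymp_nonnull L"
proof
  assume "Lambda_nonnull a y"
  then obtain L' where L': "is_Lambda a y L'" "\<not> L' \<longlonglongrightarrow> 0"
    by (auto simp: Lambda_nonnull_def asymp_nonnull_def)
  show "asymp_nonnull L"
    unfolding asymp_nonnull_def
    using L' Lim_transform2[OF _ is_Lambda_unique[OF assms L'(1)]] by (metis)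
qed (use assms in \<open>auto simp: Lambda_nonnull_def\<close>)

lemma is_Lambda_exists:
  assumes "\<And>n. n \<ge> 1 \<Longrightarrow> 0 < a n" and "y \<in> B_space a"
  shows "is_Lambda a y (\<lambda>n. y n / a n)"
proof -
  obtain C :: ereal where C: "limsup (\<lambda>n. ereal (\<bar>y n\<bar> / a n)) < C" "C < \<infinity>"
    using assms(2) dense unfolding B_space_def by blast
  have "\<forall>\<^sub>F n in sequentially. ereal (\<bar>y n\<bar> / a n) < C"
    using C(1) by (rule Limsup_lessD)
  then have "\<forall>\<^sub>F n in sequentially. norm (y n / a n) \<le> real_of_ereal C"
    using eventually_ge_at_top[of "1::nat"]
  proof eventually_elim
    case (elim n)
    then show ?case
      using C(2) assms(1)[of n] by (cases C) (auto simp: abs_div)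
  qed
  then show ?thesis
    by (auto simp: is_Lambda_def intro: BfunI)
qed

end

theory Submission
  imports Defs
begin

text \<open>
  The difference \<open>x - H\<close> is the convolution of the summable kernel \<open>k\<close> with \<open>f \<circ> x\<close>, and this
  feedback is negligible against the scale \<open>a\<close>. Write \<open>K = (\<Sum>j. \<bar>k j\<bar>)\<close>. Since \<open>f\<close> is continuous
  and sublinear, for every \<open>\<epsilon> > 0\<close> there is \<open>M\<close> with \<open>\<bar>f u\<bar> \<le> M + \<epsilon> * \<bar>u\<bar>\<close> everywhere, so the
  feedback at time \<open>n + 1\<close> is at most \<open>K * (M + \<epsilon> * V)\<close>, where \<open>V\<close> bounds \<open>\<bar>x j\<bar>\<close> for \<open>j \<le> n\<close>
  (\<open>feedback_bound\<close>).

  This is used twice. With one fixed \<open>\<epsilon>\<close> such that \<open>K * \<epsilon> \<le> 1/2\<close>, the feedback is absorbed into an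
  inductive bound on \<open>x\<close>, and \<open>H \<in> B_space a\<close> gives \<open>x \<in> B_space a\<close>
  (\<open>solution_in_B_space\<close>). With \<open>\<epsilon>\<close> arbitrarily small, \<open>x \<in> B_space a\<close> gives
  \<open>(x n - H n) / a n \<longlonglongrightarrow> 0\<close>, because \<open>V\<close> is then at most of the order of \<open>a (n + 1)\<close> by monotonicity and the
  constants vanish after division by \<open>a (n + 1) \<rightarrow> \<infinity>\<close> (\<open>solution_asymp_forcing\<close>). Hence \<open>x\<close> and \<open>H\<close>
  lie in \<open>B_space a\<close> simultaneously, and then they have the same limiting profiles \<open>\<Lambda>\<^sub>a\<close>; in
  particular one is asymptotically non-null exactly when the other is.
\<close>

section \<open>Sequences of order at most \<open>a\<close>\<close>

lemma B_space_iff_Bseq: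
  assumes "\<And>n. n \<ge> 1 \<Longrightarrow> 0 < a n"
  shows "y \<in> B_space a \<longleftrightarrow> Bseq (\<lambda>n. y n / a n)"
proof
  assume "y \<in> B_space a"
  then show "Bseq (\<lambda>n. y n / a n)"
    using is_Lambda_exists[of a y] assms by (simp add: is_Lambda_def)
next
  assume "Bseq (\<lambda>n. y n / a n)"
  then obtain C where C: "C > 0" "\<And>n. norm (y n / a n) \<le> C"
    by (auto elim: BseqE)
  have "limsup (\<lambda>n. ereal (\<bar>y n\<bar> / a n)) \<le> ereal C"
  proof (rule Limsup_bounded)
    show "\<forall>\<^sub>F n in sequentially. ereal (\<bar>y n\<bar> / a n) \<le> ereal C"
      using eventually_ge_at_top[of "1::nat"]
    proof eventually_elim
      case (elim n)
      then show ?case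
        using C(2)[of n] assms[of n] by (simp add: abs_div)
    qed
  qed
  then show "y \<in> B_space a"
    unfolding B_space_def using le_less_trans[of _ "ereal C" "\<infinity>"] by simp
qed

text \<open>
  Monotonicity of \<open>a\<close> turns the pointwise bound into a bound on the whole history of \<open>y\<close> up to
  time \<open>n\<close>, which is what a convolution sees. The constant \<open>D\<close> accounts for the index \<open>0\<close>, where
  nothing is known about \<open>a\<close>.
\<close>

lemma B_space_history_bound:
  assumes "mono_on {1..} a" and pos: "\<And>n. n \<ge> 1 \<Longrightarrow> 0 < a n" and "y \<in> B_space a"
  obtains C D where "0 \<le> C" "0 \<le> D" "\<And>n j. 1 \<le> n \<Longrightarrow> j \<le> n \<Longrightarrow> \<bar>y j\<bar> \<le> D + C * a n"
proof -
  have "Bseq (\<lambda>n. y n / a n)"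
    using assms(3) B_space_iff_Bseq[of a y] pos by blast
  then obtain C where C: "C > 0" "\<And>n. norm (y n / a n) \<le> C"
    by (auto elim: BseqE)
  have "\<bar>y j\<bar> \<le> \<bar>y 0\<bar> + C * a n" if "1 \<le> n" "j \<le> n" for n j
  proof (cases "j = 0")
    case True
    then show ?thesis
      using C(1) pos[OF that(1)] by simp
  next
    case False
    then have "\<bar>y j\<bar> \<le> C * a j"
      using C(2)[of j] pos[of j] by (simp add: abs_div divide_le_eq)
    also have "\<dots> \<le> C * a n"
      using False that C(1) mono_onD[OF assms(1), of j n] by (intro mult_left_mono) auto
    finally show ?thesis by simp
  qed
  then show ?thesis
    using that[of C "\<bar>y 0\<bar>"] C(1) by auto
qed

section \<open>Smallness of the feedback term\<close>

lemma sublinear_bound: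
  fixes f :: "real \<Rightarrow> real"
  assumes "continuous_on UNIV f" and "((\<lambda>u. f u / u) \<longlongrightarrow> 0) at_infinity" and "\<epsilon> > 0"
  obtains M where "0 \<le> M" "\<And>u. \<bar>f u\<bar> \<le> M + \<epsilon> * \<bar>u\<bar>"
proof -
  have "\<forall>\<^sub>F u in at_infinity. \<bar>f u / u\<bar> < \<epsilon>"
    using tendstoD[OF assms(2,3)] by (simp add: dist_real_def)
  then obtain R where R: "\<And>u. R \<le> \<bar>u\<bar> \<Longrightarrow> \<bar>f u / u\<bar> < \<epsilon>"
    by (auto simp: eventually_at_infinity)
  have "bounded (f ` cball 0 R)"
    by (intro compact_imp_bounded compact_continuous_image continuous_on_subset[OF assms(1)]) auto
  then obtain M where M: "M > 0" "\<And>u. \<bar>u\<bar> \<le> R \<Longrightarrow> \<bar>f u\<bar> \<le> M"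
    by (auto simp: bounded_pos)
  \<comment> \<open>The value at \<open>u = 0\<close> needs separate care, since \<open>f 0 / 0 = 0\<close> says nothing about \<open>f 0\<close>.\<close>
  have "\<bar>f u\<bar> \<le> (M + \<bar>f 0\<bar>) + \<epsilon> * \<bar>u\<bar>" for u
  proof (cases "\<bar>u\<bar> \<le> R \<or> u = 0")
    case True
    then have "\<bar>f u\<bar> \<le> M + \<bar>f 0\<bar>"
      using M(1) M(2)[of u] by auto
    moreover have "0 \<le> \<epsilon> * \<bar>u\<bar>"
      using assms(3) by simp
    ultimately show ?thesis by linarith
  next
    case False
    then have "\<bar>f u\<bar> < \<epsilon> * \<bar>u\<bar>"
      using R[of u] by (simp add: abs_div divide_less_eq)
    then show ?thesis
      using M(1) by simp
  qed
  then show ?thesis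
    using that[of "M + \<bar>f 0\<bar>"] M(1) by simp
qed

lemma convolution_bound:
  fixes k g :: "nat \<Rightarrow> real"
  assumes "summable (\<lambda>j. \<bar>k j\<bar>)" and "\<And>j. j \<le> n \<Longrightarrow> \<bar>g j\<bar> \<le> B"
  shows "\<bar>\<Sum>j=0..n. k (n - j) * g j\<bar> \<le> (\<Sum>j. \<bar>k j\<bar>) * B"
proof -
  have B: "0 \<le> B"
    using assms(2)[of 0] by simp
  have "\<bar>\<Sum>j=0..n. k (n - j) * g j\<bar> \<le> (\<Sum>j=0..n. \<bar>k (n - j)\<bar> * B)"
    by (intro order_trans[OF sum_abs] sum_mono) (auto simp: abs_mult intro: mult_left_mono assms(2))
  also have "\<dots> = (\<Sum>j=0..n. \<bar>k (n - j)\<bar>) * B"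
    by (simp add: sum_distrib_right)
  also have "(\<Sum>j=0..n. \<bar>k (n - j)\<bar>) = (\<Sum>j=0..n. \<bar>k j\<bar>)"
    using sum.nat_diff_reindex[of "\<lambda>j. \<bar>k j\<bar>" "Suc n"] by (simp add: atLeast0AtMost lessThan_Suc_atMost)
  also have "\<dots> * B \<le> (\<Sum>j. \<bar>k j\<bar>) * B"
    using B assms(1) by (intro mult_right_mono sum_le_suminf) auto
  finally show ?thesis .
qed

lemma feedback_bound:
  fixes k x :: "nat \<Rightarrow> real" and f :: "real \<Rightarrow> real"
  assumes "summable (\<lambda>j. \<bar>k j\<bar>)" and "\<And>u. \<bar>f u\<bar> \<le> M + \<epsilon> * \<bar>u\<bar>" and "0 \<le> \<epsilon>"
    and "\<And>j. j \<le> n \<Longrightarrow> \<bar>x j\<bar> \<le> V"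
  shows "\<bar>\<Sum>j=0..n. k (n - j) * f (x j)\<bar> \<le> (\<Sum>j. \<bar>k j\<bar>) * (M + \<epsilon> * V)"
proof (rule convolution_bound[OF assms(1)])
  fix j assume "j \<le> n"
  then show "\<bar>f (x j)\<bar> \<le> M + \<epsilon> * V"
    using assms(2)[of "x j"] mult_left_mono[OF assms(4)[of j] assms(3)] by linarith
qed

section \<open>The solution against its forcing\<close>

text \<open>
  A discrete Gronwall-type absorption: once the feedback gain is at most \<open>1/2\<close>, doubling the
  coefficient of \<open>a\<close> in the bound on \<open>H\<close> yields a bound that reproduces itself along the
  recursion.
\<close>

lemma solution_in_B_space:
  fixes f :: "real \<Rightarrow> real" and k H x a :: "nat \<Rightarrow> real"
  assumes f: "continuous_on UNIV f" "((\<lambda>u. f u / u) \<longlongrightarrow> 0) at_infinity"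
    and k: "summable (\<lambda>j. \<bar>k j\<bar>)"
    and rec: "\<And>n. x (Suc n) = H (Suc n) + (\<Sum>j=0..n. k (n - j) * f (x j))"
    and a: "mono_on {1..} a" "\<And>n. n \<ge> 1 \<Longrightarrow> 0 < a n" "filterlim a at_top sequentially"
    and H: "H \<in> B_space a"
  shows "x \<in> B_space a"
proof -
  define K where "K = (\<Sum>j. \<bar>k j\<bar>)"
  have K: "K \<ge> 0"
    unfolding K_def by (rule suminf_nonneg[OF k]) simp
  define \<epsilon> where "\<epsilon> = 1 / (2 * (K + 1))"
  have \<epsilon>: "\<epsilon> > 0" "K * \<epsilon> \<le> 1 / 2"
    using K by (auto simp: \<epsilon>_def field_simps)
  obtain M where M: "0 \<le> M" "\<And>u. \<bar>f u\<bar> \<le> M + \<epsilon> * \<bar>u\<bar>"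
    using sublinear_bound[OF f \<epsilon>(1)] by blast
  obtain C D where C: "0 \<le> C" "0 \<le> D"
    and H_le: "\<And>n j. 1 \<le> n \<Longrightarrow> j \<le> n \<Longrightarrow> \<bar>H j\<bar> \<le> D + C * a n"
    using B_space_history_bound[OF a(1,2) H] by blast
  \<comment> \<open>\<open>E\<close> dominates the initial value and solves \<open>D + K * M + E / 2 \<le> E\<close>.\<close>
  define E where "E = \<bar>x 0\<bar> + 2 * (D + K * M)"
  have E: "E \<ge> 0" "\<bar>x 0\<bar> \<le> E" "D + K * M + E / 2 \<le> E"
    using C K M(1) by (auto simp: E_def)
  have x_le: "\<bar>x m\<bar> \<le> E + 2 * C * a n" if n: "1 \<le> n" and "m \<le> n" for m n
    using \<open>m \<le> n\<close>
  proof (induction m rule: less_induct)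
    case (less m)
    have V: "0 \<le> E + 2 * C * a n"
      using E(1) C(1) a(2)[OF n] by simp
    show ?case
    proof (cases m)
      case 0
      then show ?thesis
        using E(2) C(1) a(2)[OF n] by (simp add: add_increasing2)
    next
      case (Suc i)
      have "\<bar>x j\<bar> \<le> E + 2 * C * a n" if "j \<le> i" for j
        using less that Suc by simp
      then have "\<bar>\<Sum>j=0..i. k (i - j) * f (x j)\<bar> \<le> K * (M + \<epsilon> * (E + 2 * C * a n))"
        unfolding K_def using \<epsilon>(1) by (intro feedback_bound[OF k M(2)]) auto
      also have "\<dots> = K * M + (K * \<epsilon>) * (E + 2 * C * a n)"
        by (simp add: algebra_simps)
      also have "\<dots> \<le> K * M + (1 / 2) * (E + 2 * C * a n)"
        using mult_right_mono[OF \<epsilon>(2) V] by simp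
      finally have "\<bar>x m\<bar> \<le> (D + C * a n) + (K * M + (1 / 2) * (E + 2 * C * a n))"
        using rec[of i] H_le[OF n less.prems] Suc by simp
      then show ?thesis
        using E(3) by (simp add: algebra_simps)
    qed
  qed
  have "\<forall>\<^sub>F n in sequentially. norm (x n / a n) \<le> E + 2 * C"
    using eventually_ge_at_top[of "1::nat"] filterlim_at_top[THEN iffD1, OF a(3), rule_format, of 1]
  proof eventually_elim
    case (elim n)
    have "\<bar>x n\<bar> \<le> E + 2 * C * a n"
      using x_le elim(1) by blast
    also have "\<dots> \<le> (E + 2 * C) * a n"
      using mult_left_mono[OF elim(2) E(1)] by (simp add: algebra_simps)
    finally show ?case
      using elim(2) by (simp add: abs_div divide_le_eq)
  qed
  then have "Bseq (\<lambda>n. x n / a n)"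
    by (rule BfunI)
  then show ?thesis
    using B_space_iff_Bseq[of a x] a(2) by blast
qed

lemma solution_asymp_forcing:
  fixes f :: "real \<Rightarrow> real" and k H x a :: "nat \<Rightarrow> real"
  assumes f: "continuous_on UNIV f" "((\<lambda>u. f u / u) \<longlongrightarrow> 0) at_infinity"
    and k: "summable (\<lambda>j. \<bar>k j\<bar>)"
    and rec: "\<And>n. x (Suc n) = H (Suc n) + (\<Sum>j=0..n. k (n - j) * f (x j))"
    and a: "mono_on {1..} a" "\<And>n. n \<ge> 1 \<Longrightarrow> 0 < a n" "filterlim a at_top sequentially"
    and x: "x \<in> B_space a"
  shows "(\<lambda>n. (x n - H n) / a n) \<longlonglongrightarrow> 0"
proof (rule LIMSEQ_imp_Suc, rule tendstoI)
  fix r :: real assume r: "r > 0"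
  define K where "K = (\<Sum>j. \<bar>k j\<bar>)"
  have K: "K \<ge> 0"
    unfolding K_def by (rule suminf_nonneg[OF k]) simp
  obtain C D where C: "0 \<le> C" "0 \<le> D"
    and x_le: "\<And>n j. 1 \<le> n \<Longrightarrow> j \<le> n \<Longrightarrow> \<bar>x j\<bar> \<le> D + C * a n"
    using B_space_history_bound[OF a(1,2) x] by blast
  \<comment> \<open>Half of \<open>r\<close> pays for the part \<open>K * \<epsilon> * C * a (Suc n)\<close> of the feedback that grows with \<open>a\<close>,
      the other half for the constant part.\<close>
  define \<epsilon> where "\<epsilon> = r / (2 * (K * C + 1))"
  have KC: "0 \<le> K * C"
    using K C(1) by simp
  then have \<epsilon>: "\<epsilon> > 0" "K * C * \<epsilon> \<le> r / 2"
    using r by (auto simp: \<epsilon>_def divide_le_eq add_pos_nonneg algebra_simps)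
  obtain M where M: "0 \<le> M" "\<And>u. \<bar>f u\<bar> \<le> M + \<epsilon> * \<bar>u\<bar>"
    using sublinear_bound[OF f \<epsilon>(1)] by blast
  define Q where "Q = K * (M + \<epsilon> * D)"
  have "filterlim (\<lambda>n. a (Suc n)) at_top sequentially"
    using a(3) filterlim_sequentially_Suc by blast
  then have "\<forall>\<^sub>F n in sequentially. 2 * Q / r < a (Suc n)"
    by (auto simp: filterlim_at_top_dense)
  then show "\<forall>\<^sub>F n in sequentially. dist ((x (Suc n) - H (Suc n)) / a (Suc n)) 0 < r"
  proof eventually_elim
    case (elim n)
    have pos: "0 < a (Suc n)"
      using a(2) by simp
    have "\<bar>x (Suc n) - H (Suc n)\<bar> \<le> K * (M + \<epsilon> * (D + C * a (Suc n)))"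
      unfolding K_def rec add_diff_cancel_left' using \<epsilon>(1) x_le[of "Suc n"]
      by (intro feedback_bound[OF k M(2)]) auto
    also have "\<dots> = Q + (K * C * \<epsilon>) * a (Suc n)"
      by (simp add: Q_def algebra_simps)
    also have "\<dots> \<le> Q + r / 2 * a (Suc n)"
      using mult_right_mono[OF \<epsilon>(2), of "a (Suc n)"] pos by simp
    also have "\<dots> < r * a (Suc n)"
      using elim r by (simp add: field_simps)
    finally show ?case
      using pos by (simp add: abs_div divide_less_eq)
  qed
qed

section \<open>Invariance under perturbations of order \<open>o(a)\<close>\<close>

text \<open>
  The space \<open>B_space a\<close> and the profile \<open>\<Lambda>\<^sub>a\<close> only see a sequence up to \<open>o(a)\<close>.
\<close>

lemma B_space_asymp:
  assumes pos: "\<And>n. n \<ge> 1 \<Longrightarrow> 0 < a n" and "(\<lambda>n. (y n - z n) / a n) \<longlonglongrightarrow> 0" and "y \<in> B_space a"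
  shows "z \<in> B_space a"
proof -
  have "Bseq (\<lambda>n. y n / a n)"
    using assms(3) B_space_iff_Bseq[of a y] pos by blast
  then obtain C where C: "C > 0" "\<And>n. norm (y n / a n) \<le> C"
    by (auto elim: BseqE)
  have "Bseq (\<lambda>n. (y n - z n) / a n)"
    using convergent_imp_Bseq[OF convergentI[OF assms(2)]] .
  then obtain E where E: "E > 0" "\<And>n. norm ((y n - z n) / a n) \<le> E"
    by (auto elim: BseqE)
  have "norm (z n / a n) \<le> C + E" for n
    using norm_triangle_ineq4[of "y n / a n" "(y n - z n) / a n"] C(2)[of n] E(2)[of n]
    by (simp add: diff_divide_distrib)
  then have "Bseq (\<lambda>n. z n / a n)"
    by (rule BseqI')
  then show ?thesis
    using B_space_iff_Bseq[of a z] pos by blast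
qed

lemma is_Lambda_asymp:
  assumes "(\<lambda>n. (y n - z n) / a n) \<longlonglongrightarrow> 0"
  shows "is_Lambda a y L \<longleftrightarrow> is_Lambda a z L"
proof -
  have "(\<lambda>n. y n / a n - L n) \<longlonglongrightarrow> 0 \<longleftrightarrow> (\<lambda>n. z n / a n - L n) \<longlonglongrightarrow> 0"
    by (rule Lim_transform_eq) (use assms in \<open>simp add: diff_divide_distrib\<close>)
  then show ?thesis
    by (simp add: is_Lambda_def tendsto_rabs_zero_iff)
qed

theorem theorem4:
  fixes f :: "real \<Rightarrow> real" and k H x a :: "nat \<Rightarrow> real" and \<xi> :: real
  assumes "continuous_on UNIV f"
    and "((\<lambda>u. f u / u) \<longlongrightarrow> 0) at_infinity"
    and "summable (\<lambda>j. \<bar>k j\<bar>)"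
    and "x 0 = \<xi>"
    and "\<And>n. x (Suc n) = H (Suc n) + (\<Sum>j=0..n. k (n - j) * f (x j))"
    and "mono_on {1..} a"
    and "\<And>n. n \<ge> 1 \<Longrightarrow> 0 < a n"
    and "filterlim a at_top sequentially"
  shows "(H \<in> B_space a \<and> Lambda_nonnull a H \<longleftrightarrow> x \<in> B_space a \<and> Lambda_nonnull a x)
    \<and> (H \<in> B_space a \<and> Lambda_nonnull a H \<longrightarrow> (\<forall>L. is_Lambda a H L \<longrightarrow> is_Lambda a x L))
    \<and> (x \<in> B_space a \<and> Lambda_nonnull a x \<longrightarrow> (\<forall>L. is_Lambda a H L \<longrightarrow> is_Lambda a x L))"
proof -
  note system = assms(1,2,3,5-8)
  have forcing: "(\<lambda>n. (x n - H n) / a n) \<longlonglongrightarrow> 0" if "x \<in> B_space a"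
    by (rule solution_asymp_forcing[where f = f and k = k]) (fact system that)+
  have B: "x \<in> B_space a \<longleftrightarrow> H \<in> B_space a"
  proof
    assume "x \<in> B_space a"
    with forcing show "H \<in> B_space a"
      using B_space_asymp[of a x H] assms(7) by blast
  next
    assume H: "H \<in> B_space a"
    show "x \<in> B_space a"
      by (rule solution_in_B_space[where f = f and k = k]) (fact system H)+
  qed
  have same_Lambda: "is_Lambda a x = is_Lambda a H" if "x \<in> B_space a"
    by (rule ext) (rule is_Lambda_asymp[OF forcing[OF that]])
  show ?thesis
  proof (cases "x \<in> B_space a")
    case True
    then show ?thesis
      using B same_Lambda by (simp add: Lambda_nonnull_def)
  next
    case False
    then show ?thesis
      using B by simp
  qed
qed

end
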